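(* Let $\mathcal{C}$ be a circle and let $\mathcal{E}'$ be an ellipse contained in the interior of $\mathcal{C}$ such that $(\mathcal{C},\mathcal{E}')$ admits a Poncelet family of triangles inscribed in $\mathcal{C}$ and circumscribed about $\mathcal{E}'$. Let $F$ be a fixed point on $\mathcal{C}$. For each triangle $T$ of the family, let $V=V(T)$ be the perpendicular projection of $F$ onto the Simson line of $T$ with respect to $F$. Then, as $T$ ranges over the whole Poncelet family, the locus of $V(T)$ is a circle.
   Context: Poncelet family: given a circle $\mathcal{C}$ and an ellipse $\mathcal{E}'$ (a circle being allowed) in its interior, suppose there is a triangle with its three vertices on $\mathcal{C}$ and its three sides tangent to $\mathcal{E}'$. By Poncelet's closure theorem, every point of $\mathcal{C}$ is then a vertex of such a triangle; the Poncelet family is the one-parameter family of all these triangles. The ellipse $\mathcal{E}'$ is called the caustic; it is arbitrary (it need not be concentric with $\mathcal{C}$). Simson line: for a triangle $T$ and a point $F$ on its circumcircle, the feet of the perpendiculars dropped from $F$ onto the three sidelines of $T$ lie on a common line, called the Simson line of $T$ with respect to $F$. Locus: the set of all points $V(T)$ as $T$ ranges over the family. *)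

theory Defs
  imports "HOL-Analysis.Analysis"
begin

text \<open>The Euclidean plane is modelled by the type \<^typ>\<open>complex\<close>, with its metric
  and its real inner product.\<close>

definition is_line :: "complex set \<Rightarrow> bool" where
  "is_line l \<longleftrightarrow> affine l \<and> aff_dim l = 1"

definition sideline :: "complex \<Rightarrow> complex \<Rightarrow> complex set" where
  "sideline A B = affine hull {A, B}"

text \<open>Foci \<open>f\<close>, \<open>g\<close> and major axis of length \<open>s\<close>; the case \<open>f = g\<close> is a circle of
  radius \<open>s / 2\<close>.  The strict inequality excludes degenerate ellipses.\<close>

definition is_ellipse :: "complex set \<Rightarrow> bool" where
  "is_ellipse E \<longleftrightarrow> (\<exists>f g s. dist f g < s \<and> E = {z. dist z f + dist z g = s})"

text \<open>For an ellipse, a line is tangent iff it meets the curve in exactly one point.\<close>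

definition tangent_to :: "complex set \<Rightarrow> complex set \<Rightarrow> bool" where
  "tangent_to l E \<longleftrightarrow> is_line l \<and> (\<exists>!z. z \<in> l \<and> z \<in> E)"

text \<open>Triangles are given by their labelled vertices, so each triangle occurs once for
  every labelling.\<close>

definition poncelet_family :: "complex set \<Rightarrow> complex set \<Rightarrow> (complex \<times> complex \<times> complex) set"
  where
  "poncelet_family K E =
     {(A, B, C). \<not> collinear {A, B, C} \<and> A \<in> K \<and> B \<in> K \<and> C \<in> K \<and>
        tangent_to (sideline B C) E \<and> tangent_to (sideline C A) E \<and>
        tangent_to (sideline A B) E}"

definition perp_foot :: "complex \<Rightarrow> complex set \<Rightarrow> complex" where
  "perp_foot P l = (THE V. V \<in> l \<and> (\<forall>Q\<in>l. orthogonal (P - V) (Q - V)))"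

text \<open>For a nondegenerate triangle and \<open>F\<close> on its circumcircle, the three feet are
  collinear but never all equal (if \<open>F\<close> is a vertex, they are \<open>F\<close>, \<open>F\<close> and the foot of
  the altitude from \<open>F\<close>), so the line below exists and is unique.\<close>

definition simson_line :: "complex \<times> complex \<times> complex \<Rightarrow> complex \<Rightarrow> complex set" where
  "simson_line T F = (case T of (A, B, C) \<Rightarrow>
     (THE l. is_line l \<and> perp_foot F (sideline B C) \<in> l \<and>
        perp_foot F (sideline C A) \<in> l \<and> perp_foot F (sideline A B) \<in> l))"

definition is_circle :: "complex set \<Rightarrow> bool" where
  "is_circle K \<longleftrightarrow> (\<exists>c r. r > 0 \<and> K = sphere c r)"

end

theory Submission
  imports Defs "HOL-Computational_Algebra.Fundamental_Theorem_Algebra"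
begin

text \<open>Normalise the circle to the unit circle, and let \<open>f\<close>, \<open>g\<close> be the foci of the ellipse. Tangency of a
  chord is a symmetric polynomial condition on its endpoints, quadratic in each of them. For a triangle
  \<open>a\<close>, \<open>b\<close>, \<open>c\<close> of the family, Vieta's formulas turn the three conditions into the statement that
  \<open>a\<close>, \<open>b\<close>, \<open>c\<close> are the roots \<open>z\<close> of \<open>z (z - f) (z - g) = l (1 - cnj f z) (1 - cnj g z)\<close> with
  \<open>l = a b c\<close>, and that the size of the ellipse is determined by \<open>f\<close> and \<open>g\<close>. Conversely, for
  every \<open>l\<close> on the unit circle the roots of this equation (the fibre of a Blaschke product) form a triangle of
  the family. The foot on the Simson line is a polynomial in the elementary symmetric functions of the vertices,
  and substituting their values makes it an affine function of \<open>l\<close>, with linear coefficient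
  \<open>cnj (x - f) * cnj (x - g) / 4\<close> where \<open>x\<close> is the fixed point.\<close>

section \<open>Ellipses given by their foci, and their tangent lines\<close>

lemma quadratic_ex1_iff:
  fixes a b c :: real
  assumes "a > 0"
  shows "(\<exists>!t. a * t\<^sup>2 + b * t + c = 0) \<longleftrightarrow> b\<^sup>2 - 4 * a * c = 0"
proof -
  define d where "d = b\<^sup>2 - 4 * a * c"
  have root: "a * t\<^sup>2 + b * t + c = 0 \<longleftrightarrow> (2 * a * t + b)\<^sup>2 = d" for t
  proof -
    have "(2 * a * t + b)\<^sup>2 - d = 4 * a * (a * t\<^sup>2 + b * t + c)"
      unfolding d_def by algebra
    then show ?thesis using assms by auto
  qed
  have "(\<exists>!t. (2 * a * t + b)\<^sup>2 = d) \<longleftrightarrow> d = 0"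
  proof
    assume "\<exists>!t. (2 * a * t + b)\<^sup>2 = d"
    then obtain t where t: "(2 * a * t + b)\<^sup>2 = d"
      and uniq: "\<And>t'. (2 * a * t' + b)\<^sup>2 = d \<Longrightarrow> t' = t" by blast
    \<comment> \<open>The roots lie symmetrically about \<open>- b / (2 * a)\<close>, so the mirror
      image of a root is a root; uniqueness puts \<open>t\<close> at the centre.\<close>
    have "2 * a * (- t - b / a) + b = - (2 * a * t + b)"
      using assms by (simp add: field_simps)
    then have "(2 * a * (- t - b / a) + b)\<^sup>2 = d" using t by (simp only: power2_minus)
    then have "- t - b / a = t" by (rule uniq)
    then have "2 * a * t + b = 0" using assms by (simp add: field_simps)
    then show "d = 0" using t by simp
  next
    assume "d = 0"
    moreover have "2 * a * t + b = 0 \<longleftrightarrow> t = - b / (2 * a)" for t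
      using assms by (auto simp: field_simps)
    ultimately have "(2 * a * t + b)\<^sup>2 = d \<longleftrightarrow> t = - b / (2 * a)" for t
      by simp
    then show "\<exists>!t. (2 * a * t + b)\<^sup>2 = d" by simp
  qed
  then show ?thesis unfolding root d_def .
qed

text \<open>Removes the square roots. The difference of the two squared sides splits into four
  linear factors in the distances; the triangle inequality and \<open>dist f g < s\<close> keep
  three of them positive, so squaring adds no points.\<close>

lemma dist_sum_eq_iff:
  fixes z f g :: "'a::metric_space"
  assumes "dist f g < s"
  shows "dist z f + dist z g = s \<longleftrightarrow>
    4 * s\<^sup>2 * (dist z g)\<^sup>2 = (s\<^sup>2 + (dist z g)\<^sup>2 - (dist z f)\<^sup>2)\<^sup>2"
proof -
  define x y where "x = dist z f" and "y = dist z g"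
  have lt: "x < y + s" "y < x + s" "0 < s"
    using assms dist_triangle[of z f g] dist_triangle[of z g f] zero_le_dist[of f g]
    by (auto simp: x_def y_def dist_commute simp del: zero_le_dist)
  have nonneg: "0 \<le> x" "0 \<le> y" by (simp_all add: x_def y_def)
  have "4 * s\<^sup>2 * y\<^sup>2 - (s\<^sup>2 + y\<^sup>2 - x\<^sup>2)\<^sup>2 =
    (x + y - s) * (x + y + s) * (s + y - x) * (s + x - y)"
    by algebra
  moreover have "x + y + s \<noteq> 0" "s + y - x \<noteq> 0" "s + x - y \<noteq> 0"
    using lt nonneg by auto
  ultimately have "4 * s\<^sup>2 * y\<^sup>2 = (s\<^sup>2 + y\<^sup>2 - x\<^sup>2)\<^sup>2 \<longleftrightarrow> x + y - s = 0"
    by (metis (no_types, lifting) eq_iff_diff_eq_0 mult_eq_0_iff)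
  then show ?thesis by (auto simp: x_def y_def)
qed

lemma ex1_range_iff: "inj h \<Longrightarrow> (\<exists>!z. z \<in> range h \<and> P z) \<longleftrightarrow> (\<exists>!t. P (h t))"
proof -
  assume "inj h"
  then have "h t = h t' \<longleftrightarrow> t = t'" for t t' by (simp add: inj_eq)
  then show ?thesis by blast
qed

lemma is_line_sideline: "B \<noteq> C \<Longrightarrow> is_line (sideline B C)"
  by (simp add: is_line_def sideline_def)

lemma sideline_eq_range: "sideline B C = range (\<lambda>t. B + of_real t * (C - B))"
  unfolding sideline_def affine_hull_2_alt by (simp add: scaleR_conv_of_real)

text \<open>The point \<open>B + t (C - B)\<close> lies on the ellipse iff a quadratic polynomial in \<open>t\<close> vanishes; the
  factor of its discriminant that can vanish compares \<open>s\<^sup>2 - (dist f g)\<^sup>2\<close> with four times the product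
  of the signed distances of the foci from the line.\<close>

lemma tangent_to_ellipse_iff:
  assumes fg: "dist f g < s" and "B \<noteq> C"
  shows "tangent_to (sideline B C) {z. dist z f + dist z g = s} \<longleftrightarrow>
    (s\<^sup>2 - (dist f g)\<^sup>2) * (cmod (C - B))\<^sup>2 =
      4 * Im ((f - B) * cnj (C - B)) * Im ((g - B) * cnj (C - B))"
proof -
  \<comment> \<open>In the frame with origin \<open>B\<close> and first axis along
    \<open>C - B\<close>, scaled by \<open>cmod (C - B)\<close>, the foci have coordinates
    \<open>(a, p)\<close> and \<open>(c, q)\<close>.\<close>
  define a p where "a = Re ((f - B) * cnj (C - B))" and "p = Im ((f - B) * cnj (C - B))"
  define c q where "c = Re ((g - B) * cnj (C - B))" and "q = Im ((g - B) * cnj (C - B))"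
  define N where "N = (cmod (C - B))\<^sup>2"
  define S where "S = s\<^sup>2 * N"
  define m where "m = S + c\<^sup>2 + q\<^sup>2 - a\<^sup>2 - p\<^sup>2"
  have N: "N > 0" using assms by (simp add: N_def)
  have s: "s > 0" using fg zero_le_dist[of f g] by linarith
  have dist_scaled: "(dist (B + of_real t * (C - B)) w)\<^sup>2 * N =
      (t * N - Re ((w - B) * cnj (C - B)))\<^sup>2 + (Im ((w - B) * cnj (C - B)))\<^sup>2" for t w
    unfolding N_def dist_norm cmod_power2 by (simp add: algebra_simps power2_eq_square)
  have fgN: "(dist f g)\<^sup>2 * N = (a - c)\<^sup>2 + (p - q)\<^sup>2"
    unfolding N_def dist_norm cmod_power2 a_def c_def p_def q_def
    by (simp add: algebra_simps power2_eq_square)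
  have "(dist f g)\<^sup>2 < s\<^sup>2" using fg by (simp add: power_strict_mono)
  then have lt: "(a - c)\<^sup>2 + (p - q)\<^sup>2 < S"
    unfolding fgN[symmetric] S_def using N by simp
  then have pos: "0 < S - (a - c)\<^sup>2"
    using zero_le_power2[of "p - q"] by linarith
  have mem: "dist (B + of_real t * (C - B)) f + dist (B + of_real t * (C - B)) g = s \<longleftrightarrow>
    (4 * N\<^sup>2 * (S - (a - c)\<^sup>2)) * t\<^sup>2 + (- N * (8 * S * c + 4 * (a - c) * m)) * t
      + (4 * S * (c\<^sup>2 + q\<^sup>2) - m\<^sup>2) = 0" (is "?L \<longleftrightarrow> ?Q = 0") for t
  proof -
    define X Y where "X = (dist (B + of_real t * (C - B)) f)\<^sup>2"
      and "Y = (dist (B + of_real t * (C - B)) g)\<^sup>2"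
    have XY: "X * N = (t * N - a)\<^sup>2 + p\<^sup>2" "Y * N = (t * N - c)\<^sup>2 + q\<^sup>2"
      unfolding X_def Y_def a_def p_def c_def q_def by (rule dist_scaled)+
    \<comment> \<open>Multiplying by \<open>N^2\<close> replaces both squared distances by the
      polynomials in \<open>t\<close> from \<open>XY\<close>.\<close>
    have "(4 * s\<^sup>2 * Y - (s\<^sup>2 + Y - X)\<^sup>2) * N\<^sup>2 = 4 * S * (Y * N) - (S + Y * N - X * N)\<^sup>2"
      unfolding S_def by algebra
    also have "\<dots> = ?Q" unfolding XY m_def by algebra
    finally have "(4 * s\<^sup>2 * Y - (s\<^sup>2 + Y - X)\<^sup>2) * N\<^sup>2 = ?Q" .
    moreover have "?L \<longleftrightarrow> 4 * s\<^sup>2 * Y - (s\<^sup>2 + Y - X)\<^sup>2 = 0"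
      unfolding dist_sum_eq_iff[OF fg] X_def Y_def by auto
    ultimately show ?thesis using N by (metis less_irrefl mult_eq_0_iff zero_eq_power2)
  qed
  have "inj (\<lambda>t. B + of_real t * (C - B))"
    using assms by (auto simp: inj_def)
  then have "tangent_to (sideline B C) {z. dist z f + dist z g = s} \<longleftrightarrow>
      (\<exists>!t. dist (B + of_real t * (C - B)) f + dist (B + of_real t * (C - B)) g = s)"
    using is_line_sideline[OF assms(2)]
    unfolding tangent_to_def sideline_eq_range by (simp add: ex1_range_iff)
  also have "\<dots> \<longleftrightarrow> (- N * (8 * S * c + 4 * (a - c) * m))\<^sup>2
      - 4 * (4 * N\<^sup>2 * (S - (a - c)\<^sup>2)) * (4 * S * (c\<^sup>2 + q\<^sup>2) - m\<^sup>2) = 0"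
    unfolding mem using N pos by (intro quadratic_ex1_iff) simp
  also have "(- N * (8 * S * c + 4 * (a - c) * m))\<^sup>2
      - 4 * (4 * N\<^sup>2 * (S - (a - c)\<^sup>2)) * (4 * S * (c\<^sup>2 + q\<^sup>2) - m\<^sup>2) =
      16 * N\<^sup>2 * S * (S - (a - c)\<^sup>2 - (p - q)\<^sup>2) * (S - (a - c)\<^sup>2 - (p + q)\<^sup>2)"
    unfolding m_def by algebra
  \<comment> \<open>By \<open>lt\<close>, which comes from \<open>dist f g < s\<close>, the factor
    containing \<open>p - q\<close> is positive; only the one containing \<open>p + q\<close> can
    vanish.\<close>
  also have "\<dots> = 0 \<longleftrightarrow> S - (a - c)\<^sup>2 - (p + q)\<^sup>2 = 0"
  proof -
    have "S \<noteq> 0" "S - (a - c)\<^sup>2 - (p - q)\<^sup>2 \<noteq> 0" "N\<^sup>2 \<noteq> 0"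
      using N s lt by (simp_all add: S_def)
    then show ?thesis by (simp only: mult_eq_0_iff) simp
  qed
  also have "\<dots> \<longleftrightarrow> (s\<^sup>2 - (dist f g)\<^sup>2) * N = 4 * p * q"
  proof -
    have "S - (a - c)\<^sup>2 - (p + q)\<^sup>2 = (s\<^sup>2 - (dist f g)\<^sup>2) * N - 4 * p * q"
      unfolding left_diff_distrib fgN S_def by algebra
    then show ?thesis by simp
  qed
  finally show ?thesis unfolding N_def p_def q_def .
qed

text \<open>The foci lie on the segment joining the two ends of the major axis, and these ends are
  points of the ellipse.\<close>

lemma foci_in_convex:
  assumes "dist f g < s" and "{z. dist z f + dist z g = s} \<subseteq> U" and "convex U"
  shows "f \<in> U" and "(g::complex) \<in> U"
proof -
  define d where "d = dist f g"
  obtain u where u: "cmod u = 1" "g - f = of_real d * u"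
  proof (cases "f = g")
    case True
    then show ?thesis using that[of 1] by (simp add: d_def)
  next
    case False
    then have "g - f = of_real d * sgn (g - f)"
      by (simp add: d_def dist_norm norm_minus_commute sgn_eq)
    moreover have "cmod (sgn (g - f)) = 1" using False by (simp add: norm_sgn)
    ultimately show ?thesis using that by blast
  qed
  have d: "0 \<le> d" "d < s" using assms by (auto simp: d_def)
  have g: "g = f + of_real d * u" using u by (simp add: algebra_simps)
  \<comment> \<open>The ends of the major axis: \<open>P\<close> beyond \<open>f\<close> and
    \<open>Q\<close> beyond \<open>g\<close>, each at distance \<open>(s - d) / 2\<close> from the
    nearer focus.\<close>
  define P Q where "P = f - of_real ((s - d) / 2) * u" and "Q = f + of_real ((s + d) / 2) * u"
  have "dist P f = (s - d) / 2" "dist Q f = (s + d) / 2"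
    using u d by (simp_all add: P_def Q_def dist_norm norm_mult del: of_real_divide)
  moreover have "P - g = of_real (- (s + d) / 2) * u" "Q - g = of_real ((s - d) / 2) * u"
    by (simp_all add: P_def Q_def g field_simps)
  then have "dist P g = (s + d) / 2" "dist Q g = (s - d) / 2"
    using u d by (simp_all add: dist_norm norm_mult del: of_real_divide)
  ultimately have "P \<in> U" "Q \<in> U" using assms(2) by auto
  then have seg: "(1 - t) *\<^sub>R P + t *\<^sub>R Q \<in> U" if "0 \<le> t" "t \<le> 1" for t
    using assms(3) that by (simp add: convex_alt)
  have comb: "(1 - t) *\<^sub>R P + t *\<^sub>R Q = f + of_real (t * s - (s - d) / 2) * u" for t
    by (simp add: P_def Q_def scaleR_conv_of_real field_simps)
  \<comment> \<open>The parameters at which the segment from \<open>P\<close> to \<open>Q\<close>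
    passes through \<open>f\<close> and \<open>g\<close>.\<close>
  have "(s - d) / (2 * s) * s - (s - d) / 2 = 0" "(s + d) / (2 * s) * s - (s - d) / 2 = d"
    using d by (simp_all add: field_simps)
  moreover have "0 \<le> (s - d) / (2 * s)" "(s - d) / (2 * s) \<le> 1"
      "0 \<le> (s + d) / (2 * s)" "(s + d) / (2 * s) \<le> 1"
    using d by simp_all
  ultimately show "f \<in> U" "g \<in> U"
    using seg[of "(s - d) / (2 * s)"] seg[of "(s + d) / (2 * s)"] unfolding comb g by (simp_all only: of_real_0 mult_zero_left add_0_right)
qed

section \<open>The tangency condition for chords of the unit circle\<close>

lemma mult_cnj_unit: "cmod a = 1 \<Longrightarrow> a * cnj a = 1"
  by (simp add: complex_norm_square[symmetric])

lemma cnj_unit: "cmod a = 1 \<Longrightarrow> cnj a = 1 / a"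
  using mult_cnj_unit[of a] by (metis mult.commute mult_zero_left nonzero_eq_divide_eq zero_neq_one)

text \<open>For \<open>b\<close>, \<open>c\<close> on the unit circle, this is the equation \<open>d\<^sub>f d\<^sub>g = k / 4\<close>, where \<open>d\<^sub>f\<close> and \<open>d\<^sub>g\<close> are
  the signed distances of the foci from the line through \<open>b\<close> and \<open>c\<close>; that line consists of the \<open>z\<close>
  with \<open>z + b c cnj z = b + c\<close>.\<close>

definition chord_condition :: "complex \<Rightarrow> complex \<Rightarrow> real \<Rightarrow> complex \<Rightarrow> complex \<Rightarrow> bool" where
  "chord_condition f g k b c \<longleftrightarrow>
     (f + b * c * cnj f - b - c) * (g + b * c * cnj g - b - c) = of_real k * (b * c)"

lemma chord_condition_commute: "chord_condition f g k b c = chord_condition f g k c b"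
  by (simp add: chord_condition_def algebra_simps)

text \<open>Conjugation is inversion on the unit circle, so
  \<open>Im ((w - b) * cnj (c - b))\<close> equals \<open>w + b * c * cnj w - b - c\<close> up to
  the nonzero factor \<open>(b - c) / (2 * \<i> * b * c)\<close>. Multiplying the cases
  \<open>w = f\<close> and \<open>w = g\<close> gives the claim.\<close>

lemma chord_condition_iff:
  assumes "cmod b = 1" "cmod c = 1" "b \<noteq> c"
  shows "chord_condition f g k b c \<longleftrightarrow>
    k * (cmod (c - b))\<^sup>2 = 4 * Im ((f - b) * cnj (c - b)) * Im ((g - b) * cnj (c - b))"
proof -
  have b: "b * cnj b = 1" and c: "c * cnj c = 1" using assms mult_cnj_unit by auto
  then have nz: "b \<noteq> 0" "c \<noteq> 0" by auto
  have im: "2 * \<i> * of_real (Im z) = z - cnj z" for z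
    by (simp add: complex_eq_iff)
  have height: "b * c * (2 * \<i> * of_real (Im ((w - b) * cnj (c - b)))) =
      (b - c) * (w + b * c * cnj w - b - c)" for w
    unfolding im complex_cnj_mult complex_cnj_diff complex_cnj_cnj using b c by algebra
  define n p q where "n = complex_of_real ((cmod (c - b))\<^sup>2)"
    and "p = complex_of_real (Im ((f - b) * cnj (c - b)))"
    and "q = complex_of_real (Im ((g - b) * cnj (c - b)))"
  have p: "b * c * (2 * \<i> * p) = (b - c) * (f + b * c * cnj f - b - c)"
    and q: "b * c * (2 * \<i> * q) = (b - c) * (g + b * c * cnj g - b - c)"
    unfolding p_def q_def by (rule height)+
  have "n = (c - b) * (cnj c - cnj b)"
    unfolding n_def complex_norm_square complex_cnj_diff ..
  then have n: "b * c * n = - ((b - c) * (b - c))"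
    using b c by algebra
  define h where "h = (f + b * c * cnj f - b - c) * (g + b * c * cnj g - b - c)"
  have "(b * c) * (b * c) * (of_real k * n - 4 * p * q) =
      of_real k * (b * c) * (b * c * n) + (b * c * (2 * \<i> * p)) * (b * c * (2 * \<i> * q))"
    by (simp add: algebra_simps)
  also have "\<dots> = (b - c) * (b - c) * (h - of_real k * (b * c))"
    unfolding p q n h_def by algebra
  finally have "of_real k * n - 4 * p * q = 0 \<longleftrightarrow> h - of_real k * (b * c) = 0"
    using nz assms(3) by (metis eq_iff_diff_eq_0 mult_eq_0_iff)
  then have "chord_condition f g k b c \<longleftrightarrow> of_real k * n = 4 * p * q"
    unfolding chord_condition_def h_def by simp
  also have "\<dots> \<longleftrightarrow> complex_of_real (k * (cmod (c - b))\<^sup>2) =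
      of_real (4 * Im ((f - b) * cnj (c - b)) * Im ((g - b) * cnj (c - b)))"
    unfolding n_def p_def q_def of_real_mult of_real_numeral ..
  finally show ?thesis unfolding of_real_eq_iff .
qed

text \<open>As an equation for \<open>x\<close>, the chord condition for \<open>a\<close>, \<open>x\<close> is quadratic, so its coefficients
  determine \<open>b + c\<close> and \<open>b c\<close>. In particular \<open>a\<close> is a root of a cubic that depends only on
  \<open>a b c\<close>.\<close>

lemma chord_condition_vieta:
  assumes "chord_condition f g k a b" "chord_condition f g k a c" "b \<noteq> c"
  shows "(1 - cnj f * a) * (1 - cnj g * a) * (b * c) = (a - f) * (a - g)"
    and "(1 - cnj f * a) * (1 - cnj g * a) * (b + c) =
      (f - a) * (1 - cnj g * a) + (g - a) * (1 - cnj f * a) + of_real k * a"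
proof -
  let ?D = "(1 - cnj f * a) * (1 - cnj g * a)"
  let ?N = "(f - a) * (1 - cnj g * a) + (g - a) * (1 - cnj f * a) + of_real k * a"
  let ?P = "(a - f) * (a - g)"
  have b: "?D * b\<^sup>2 - ?N * b + ?P = 0" and c: "?D * c\<^sup>2 - ?N * c + ?P = 0"
    using assms(1,2) unfolding chord_condition_def by algebra+
  have "(b - c) * (?D * (b * c) - ?P) = c * (?D * b\<^sup>2 - ?N * b + ?P) - b * (?D * c\<^sup>2 - ?N * c + ?P)"
    by algebra
  then show "?D * (b * c) = ?P" unfolding b c using assms(3) by simp
  have "(b - c) * (?D * (b + c) - ?N) = (?D * b\<^sup>2 - ?N * b + ?P) - (?D * c\<^sup>2 - ?N * c + ?P)"
    by algebra
  then show "?D * (b + c) = ?N" unfolding b c using assms(3) by simp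
qed

text \<open>All three vertices are roots of one monic cubic whose coefficients involve only the foci
  and \<open>a * b * c\<close>. Being distinct, they are all its roots, which gives their sum; the
  Vieta formula for \<open>b + c\<close> then determines \<open>k\<close>.\<close>

lemma chord_conditions_imp:
  assumes "chord_condition f g k a b" "chord_condition f g k b c" "chord_condition f g k c a"
    and "a \<noteq> b" "b \<noteq> c" "c \<noteq> a" and "a \<noteq> 0"
  shows "a + b + c = f + g + a * b * c * cnj f * cnj g"
    and "k = (1 - (cmod f)\<^sup>2) * (1 - (cmod g)\<^sup>2)"
proof -
  define l where "l = a * b * c"
  define s q where "s = f + g + l * cnj f * cnj g" and "q = f * g + l * (cnj f + cnj g)"
  have ac: "chord_condition f g k a c" and ba: "chord_condition f g k b a"
    and cb: "chord_condition f g k c b"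
    using assms chord_condition_commute by blast+
  note A = chord_condition_vieta[OF assms(1) ac assms(5)]
  have cubic: "x^3 - s * x\<^sup>2 + q * x - l = 0"
    if "(1 - cnj f * x) * (1 - cnj g * x) * m = (x - f) * (x - g)" "x * m = l" for x m
  proof -
    have "x^3 - s * x\<^sup>2 + q * x - l = x * ((x - f) * (x - g)) - (1 - cnj f * x) * (1 - cnj g * x) * l"
      unfolding s_def q_def by algebra
    then show ?thesis using that by (metis (no_types) eq_iff_diff_eq_0 mult.left_commute)
  qed
  have cubics: "a^3 - s * a\<^sup>2 + q * a - l = 0" "b^3 - s * b\<^sup>2 + q * b - l = 0"
      "c^3 - s * c\<^sup>2 + q * c - l = 0"
    using cubic[OF A(1)] cubic[OF chord_condition_vieta(1)[OF assms(2) ba]]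
      cubic[OF chord_condition_vieta(1)[OF assms(3) cb]] assms(4,6)
    by (simp_all add: l_def ac_simps)
  \<comment> \<open>A second divided difference with denominators cleared: the weights annihilate
    the constant and linear terms of the cubic and leave a Vandermonde factor.\<close>
  have "(a - b) * (b - c) * (a - c) * (a + b + c - s) =
      (b - c) * (a^3 - s * a\<^sup>2 + q * a - l) - (a - c) * (b^3 - s * b\<^sup>2 + q * b - l)
        + (a - b) * (c^3 - s * c\<^sup>2 + q * c - l)"
    by algebra
  then have s: "a + b + c = s" unfolding cubics using assms(4-6) by simp
  then show "a + b + c = f + g + a * b * c * cnj f * cnj g" unfolding s_def l_def .
  have bc: "b + c = f + g + l * cnj f * cnj g - a"
    using s unfolding s_def by (simp add: algebra_simps)
  have aA: "(1 - cnj f * a) * (1 - cnj g * a) * l = a * ((a - f) * (a - g))"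
    using A(1) unfolding l_def by algebra
  \<comment> \<open>Inserting \<open>bc\<close> into the second Vieta formula and eliminating
    \<open>l\<close> by \<open>aA\<close> leaves a multiple of \<open>a\<close>.\<close>
  have "a * (of_real k - (1 - f * cnj f) * (1 - g * cnj g)) = 0"
    using A(2) aA unfolding bc by algebra
  then have "complex_of_real k = (1 - f * cnj f) * (1 - g * cnj g)" using assms(7) by simp
  also have "\<dots> = of_real ((1 - (cmod f)\<^sup>2) * (1 - (cmod g)\<^sup>2))"
    by (simp add: complex_norm_square[symmetric])
  finally show "k = (1 - (cmod f)\<^sup>2) * (1 - (cmod g)\<^sup>2)" unfolding of_real_eq_iff .
qed

section \<open>Triangles with a prescribed product of vertices\<close>

lemma cubic_vieta:
  fixes s q l :: complex
  obtains a b c where "a + b + c = s" "a * b + b * c + c * a = q" "a * b * c = l"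
proof -
  have "\<not> constant (poly [:- l, q, - s, 1:])"
    by (simp add: constant_degree)
  then obtain a where "poly [:- l, q, - s, 1:] a = 0"
    using fundamental_theorem_of_algebra by blast
  then have a: "a^3 - s * a\<^sup>2 + q * a - l = 0" by (simp add: algebra_simps power2_eq_square power3_eq_cube)
  \<comment> \<open>After splitting off the root \<open>a\<close>, the other two have sum
    \<open>s - a\<close> and product \<open>q - a * (s - a)\<close>; \<open>d\<close> is a square
    root of the discriminant of their quadratic.\<close>
  define d where "d = csqrt ((s - a)\<^sup>2 - 4 * (q - a * (s - a)))"
  have d: "d\<^sup>2 = (s - a)\<^sup>2 - 4 * (q - a * (s - a))" by (simp add: d_def)
  define b c where "b = (s - a + d) / 2" and "c = (s - a - d) / 2"
  have sum: "b + c = s - a" by (simp add: b_def c_def field_simps)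
  have "4 * (b * c) = (s - a)\<^sup>2 - d\<^sup>2"
    by (simp add: b_def c_def field_simps power2_eq_square)
  also have "\<dots> = 4 * (q - a * (s - a))" unfolding d by simp
  finally have prod: "b * c = q - a * (s - a)" by (simp only: mult_cancel_left) simp
  show ?thesis
  proof (rule that[of a b c])
    show "a + b + c = s" using sum by algebra
    show "a * b + b * c + c * a = q" using sum prod by algebra
    show "a * b * c = l" using prod a by algebra
  qed
qed

text \<open>The difference of the squared moduli is
  \<open>(1 - (cmod z)^2) * (1 - (cmod w)^2)\<close>, so its sign is decided by the side of the unit
  circle on which \<open>z\<close> lies.\<close>

lemma cmod_blaschke_numerator_less:
  assumes "cmod w < 1"
  shows "cmod z < 1 \<Longrightarrow> cmod (z - w) < cmod (1 - cnj w * z)"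
    and "1 < cmod z \<Longrightarrow> cmod (1 - cnj w * z) < cmod (z - w)"
proof -
  have eq: "(cmod (1 - cnj w * z))\<^sup>2 - (cmod (z - w))\<^sup>2 = (1 - (cmod z)\<^sup>2) * (1 - (cmod w)\<^sup>2)"
    unfolding cmod_power2 by (simp add: algebra_simps power2_eq_square)
  have w: "0 < 1 - (cmod w)\<^sup>2" using assms by (simp add: power_less_one_iff)
  show "cmod (z - w) < cmod (1 - cnj w * z)" if "cmod z < 1"
  proof -
    have "0 < 1 - (cmod z)\<^sup>2" using that by (simp add: power_less_one_iff)
    then have "0 < (cmod (1 - cnj w * z))\<^sup>2 - (cmod (z - w))\<^sup>2"
      unfolding eq using w by simp
    then show ?thesis by (simp add: power_less_imp_less_base)
  qed
  show "cmod (1 - cnj w * z) < cmod (z - w)" if "1 < cmod z"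
  proof -
    have "1 - (cmod z)\<^sup>2 < 0" using that by simp
    then have "(cmod (1 - cnj w * z))\<^sup>2 - (cmod (z - w))\<^sup>2 < 0"
      unfolding eq using w by (simp add: mult_neg_pos)
    then show ?thesis by (simp add: power_less_imp_less_base)
  qed
qed

text \<open>Inside the unit circle the left side of \<open>root\<close> has strictly smaller modulus
  than the right side, outside strictly larger.\<close>

lemma blaschke_root_unit:
  assumes "cmod f < 1" "cmod g < 1" "cmod l = 1"
    and root: "z * (z - f) * (z - g) = l * (1 - cnj f * z) * (1 - cnj g * z)"
  shows "cmod z = 1"
proof -
  have eq: "cmod z * (cmod (z - f) * cmod (z - g)) = cmod (1 - cnj f * z) * cmod (1 - cnj g * z)"
    using arg_cong[OF root, of cmod] assms(3) by (simp add: norm_mult)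
  have "\<not> cmod z < 1"
  proof
    assume z: "cmod z < 1"
    have "cmod z * (cmod (z - f) * cmod (z - g)) \<le> cmod (z - f) * cmod (z - g)"
      using z by (simp add: mult_left_le_one_le)
    also have "\<dots> < cmod (1 - cnj f * z) * cmod (1 - cnj g * z)"
      using cmod_blaschke_numerator_less(1) z assms by (intro mult_strict_mono') auto
    finally show False using eq by simp
  qed
  moreover have "\<not> 1 < cmod z"
  proof
    assume z: "1 < cmod z"
    have "cmod (1 - cnj f * z) * cmod (1 - cnj g * z) < cmod (z - f) * cmod (z - g)"
      using cmod_blaschke_numerator_less(2) z assms by (intro mult_strict_mono') auto
    also have "\<dots> \<le> cmod z * (cmod (z - f) * cmod (z - g))"
      using z mult_right_mono[of 1 "cmod z" "cmod (z - f) * cmod (z - g)"] by simp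
    finally show False using eq by simp
  qed
  ultimately show ?thesis by simp
qed

text \<open>Rules out multiple roots of the cubic. For \<open>b = c\<close> the condition would read
  \<open>(d + x) * (e + y) = x * y\<close> with all four quantities positive.\<close>

lemma chord_condition_distinct:
  assumes "cmod f < 1" "cmod g < 1" "cmod b = 1"
    and "chord_condition f g ((1 - (cmod f)\<^sup>2) * (1 - (cmod g)\<^sup>2)) b c"
  shows "b \<noteq> c"
proof
  assume "b = c"
  have b: "b * cnj b = 1" using assms mult_cnj_unit by auto
  have height: "w + b * b * cnj w - b - b = - (of_real ((cmod (b - w))\<^sup>2 + (1 - (cmod w)\<^sup>2)) * b)" for w
    using b unfolding of_real_add of_real_diff complex_norm_square by (simp, algebra)
  define x y where "x = 1 - (cmod f)\<^sup>2" and "y = 1 - (cmod g)\<^sup>2"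
  define d e where "d = (cmod (b - f))\<^sup>2" and "e = (cmod (b - g))\<^sup>2"
  have "of_real ((d + x) * (e + y)) * (b * b) = of_real (x * y) * (b * b)"
    using assms(4) unfolding chord_condition_def \<open>b = c\<close>[symmetric] height d_def e_def x_def y_def
    by (simp add: algebra_simps)
  then have "(d + x) * (e + y) = x * y"
    using b by (metis mult_cancel_right mult_eq_0_iff of_real_eq_iff zero_neq_one)
  moreover have "0 < x" "0 < y" using assms by (simp_all add: x_def y_def power_less_one_iff)
  moreover have "0 < d" "0 < e" using assms by (auto simp: d_def e_def)
  then have "x * y < (d + x) * (e + y)"
    using \<open>0 < x\<close> \<open>0 < y\<close> by (intro mult_strict_mono) auto
  ultimately show False by simp
qed

text \<open>Converse to \<open>chord_conditions_imp\<close>: the vertices are the roots of the cubic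
  with the coefficients found there.\<close>

lemma chord_triangle_exists:
  assumes f: "cmod f < 1" and g: "cmod g < 1" and l: "cmod l = 1"
  defines "k \<equiv> (1 - (cmod f)\<^sup>2) * (1 - (cmod g)\<^sup>2)"
  obtains a b c where "cmod a = 1" "cmod b = 1" "cmod c = 1" "a \<noteq> b" "b \<noteq> c" "c \<noteq> a"
    "a * b * c = l"
    "chord_condition f g k a b" "chord_condition f g k b c" "chord_condition f g k c a"
proof -
  obtain a b c where sum: "a + b + c = f + g + l * cnj f * cnj g"
    and sum2: "a * b + b * c + c * a = f * g + l * (cnj f + cnj g)" and prod: "a * b * c = l"
    by (rule cubic_vieta)
  \<comment> \<open>Stated for an arbitrary naming of the roots, so that the cyclic shifts cover all
    vertices and all sides.\<close>
  have unit: "cmod x = 1" and chord: "chord_condition f g k x y"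
    if "x + y + z = f + g + l * cnj f * cnj g"
      "x * y + y * z + z * x = f * g + l * (cnj f + cnj g)" "x * y * z = l" for x y z
  proof -
    have "x^3 - (x + y + z) * x\<^sup>2 + (x * y + y * z + z * x) * x - x * y * z = 0"
      by algebra
    then have root: "x * (x - f) * (x - g) = l * (1 - cnj f * x) * (1 - cnj g * x)"
      unfolding that by algebra
    then show "cmod x = 1" by (rule blaschke_root_unit[OF f g l])
    then have "x \<noteq> 0" by auto
    have k: "complex_of_real k = (1 - f * cnj f) * (1 - g * cnj g)"
      by (simp add: k_def complex_norm_square[symmetric])
    let ?D = "(1 - cnj f * x) * (1 - cnj g * x)"
    let ?N = "(f - x) * (1 - cnj g * x) + (g - x) * (1 - cnj f * x) + of_real k * x"
    have prod: "?D * l = x * ((x - f) * (x - g))"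
      using root by algebra
    have yz: "y + z = f + g + l * cnj f * cnj g - x"
      using that(1) by (simp add: algebra_simps)
    have sum: "?D * (y + z) = ?N"
      unfolding yz k using prod by algebra
    \<comment> \<open>The chord condition as a quadratic in \<open>y\<close>. By \<open>sum\<close>
      and \<open>prod\<close> its roots are \<open>y\<close> and \<open>z\<close>; the extra factor
      \<open>x\<close> is there because \<open>prod\<close> gives the constant term only times
      \<open>x\<close>.\<close>
    have "x * ((f + x * y * cnj f - x - y) * (g + x * y * cnj g - x - y) - of_real k * (x * y)) =
        x * (?D * y\<^sup>2 - ?N * y) + x * ((x - f) * (x - g))"
      by algebra
    also have "\<dots> = 0"
      unfolding prod[symmetric] sum[symmetric] that(3)[symmetric] by algebra
    finally have "x * ((f + x * y * cnj f - x - y) * (g + x * y * cnj g - x - y)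
      - of_real k * (x * y)) = 0" .
    then show "chord_condition f g k x y"
      using \<open>x \<noteq> 0\<close> by (simp add: chord_condition_def)
  qed
  have units: "cmod a = 1" "cmod b = 1" "cmod c = 1"
    and chords: "chord_condition f g k a b" "chord_condition f g k b c" "chord_condition f g k c a"
    using unit[of a b c] unit[of b c a] unit[of c a b] chord[of a b c] chord[of b c a] chord[of c a b]
      sum sum2 prod by (simp_all add: ac_simps)
  then show ?thesis
    using that[of a b c] prod chord_condition_distinct[OF f g] unfolding k_def by blast
qed

section \<open>Sidelines, perpendicular feet and the Simson line in complex coordinates\<close>

lemma Im_eq_0_iff_cnj: "Im z = 0 \<longleftrightarrow> z = cnj z"
  by (auto simp: complex_eq_iff)

lemma Re_eq_0_iff_cnj: "Re z = 0 \<longleftrightarrow> z = - cnj z"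
  by (auto simp: complex_eq_iff)

lemma mem_sideline_iff:
  assumes "B \<noteq> C"
  shows "z \<in> sideline B C \<longleftrightarrow> Im ((z - B) * cnj (C - B)) = 0"
proof
  assume "z \<in> sideline B C"
  then obtain t where "z = B + of_real t * (C - B)" unfolding sideline_eq_range by blast
  then have "(z - B) * cnj (C - B) = of_real (t * (cmod (C - B))\<^sup>2)"
    unfolding of_real_mult complex_norm_square by simp
  then show "Im ((z - B) * cnj (C - B)) = 0" by simp
next
  assume Im: "Im ((z - B) * cnj (C - B)) = 0"
  define r where "r = Re ((z - B) * cnj (C - B))"
  have r: "(z - B) * cnj (C - B) = of_real r"
    using Im by (simp add: r_def complex_eq_iff)
  have "(z - B) * (of_real (cmod (C - B)))\<^sup>2 = of_real r * (C - B)"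
    unfolding r[symmetric] of_real_power[symmetric] complex_norm_square by simp
  then have "z = B + of_real (r / (cmod (C - B))\<^sup>2) * (C - B)"
    using assms by (simp add: field_simps)
  then show "z \<in> sideline B C" unfolding sideline_eq_range by blast
qed

text \<open>For uniqueness, the orthogonality relations of two candidates \<open>V\<close> and
  \<open>W\<close> add up to the squared length of \<open>W - V\<close>.\<close>

lemma perp_foot_eqI:
  assumes "V \<in> l" "\<forall>Q\<in>l. orthogonal (P - V) (Q - V)"
  shows "perp_foot P l = V"
  unfolding perp_foot_def
proof (rule the_equality)
  fix W assume W: "W \<in> l \<and> (\<forall>Q\<in>l. orthogonal (P - W) (Q - W))"
  have "(P - V) \<bullet> (W - V) = 0" "(P - W) \<bullet> (V - W) = 0"
    using assms W by (auto simp: orthogonal_def)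
  moreover have "(W - V) \<bullet> (W - V) = (P - V) \<bullet> (W - V) + (P - W) \<bullet> (V - W)"
    by (simp add: inner_diff inner_commute)
  ultimately show "W = V" by simp
qed (use assms in auto)

lemma perp_foot_sidelineI:
  assumes "V \<in> sideline B C" "Re ((P - V) * cnj (C - B)) = 0"
  shows "perp_foot P (sideline B C) = V"
proof (rule perp_foot_eqI)
  obtain v where v: "V = B + of_real v * (C - B)"
    using assms(1) unfolding sideline_eq_range by blast
  show "\<forall>Q\<in>sideline B C. orthogonal (P - V) (Q - V)"
  proof
    fix Q assume "Q \<in> sideline B C"
    then obtain q where "Q = B + of_real q * (C - B)" unfolding sideline_eq_range by blast
    then have "Q - V = (q - v) *\<^sub>R (C - B)"
      unfolding v by (simp add: scaleR_conv_of_real algebra_simps)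
    moreover have "(P - V) \<bullet> (C - B) = 0"
      using assms(2) by (simp add: inner_complex_def algebra_simps)
    ultimately show "orthogonal (P - V) (Q - V)"
      unfolding orthogonal_def by simp
  qed
qed (fact assms)

lemma is_line_unique:
  assumes "is_line l" "is_line m" "X \<noteq> Y" "X \<in> l" "Y \<in> l" "X \<in> m" "Y \<in> m"
  shows "l = m"
proof -
  have "sideline X Y = n" if "is_line n" "X \<in> n" "Y \<in> n" for n
  proof (rule affine_dim_equal)
    show "sideline X Y \<subseteq> n"
      unfolding sideline_def using that by (intro hull_minimal) (auto simp: is_line_def)
    show "sideline X Y \<noteq> {}" by (simp add: sideline_def)
  qed (use that is_line_sideline[OF assms(3)] in \<open>auto simp: is_line_def\<close>)
  then show ?thesis using assms by metis
qed

lemma homothety_mult_cnj: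
  "(z0 + of_real R * y - (z0 + of_real R * w)) * cnj (z0 + of_real R * y' - (z0 + of_real R * w')) =
    of_real (R\<^sup>2) * ((y - w) * cnj (y' - w'))"
  by (simp add: algebra_simps power2_eq_square)

text \<open>Lets incidence and orthogonality, which say that such an imaginary or real part
  vanishes, pass between the unit circle and \<open>sphere z0 R\<close>.\<close>

lemma Re_Im_homothety_mult_cnj:
  "Re ((z0 + of_real R * y - (z0 + of_real R * w)) * cnj (z0 + of_real R * y' - (z0 + of_real R * w'))) =
    R\<^sup>2 * Re ((y - w) * cnj (y' - w'))"
  "Im ((z0 + of_real R * y - (z0 + of_real R * w)) * cnj (z0 + of_real R * y' - (z0 + of_real R * w'))) =
    R\<^sup>2 * Im ((y - w) * cnj (y' - w'))"
proof -
  have "Re (of_real r * z) = r * Re z" "Im (of_real r * z) = r * Im z" for r z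
    by simp_all
  then show
    "Re ((z0 + of_real R * y - (z0 + of_real R * w)) * cnj (z0 + of_real R * y' - (z0 + of_real R * w'))) =
      R\<^sup>2 * Re ((y - w) * cnj (y' - w'))"
    "Im ((z0 + of_real R * y - (z0 + of_real R * w)) * cnj (z0 + of_real R * y' - (z0 + of_real R * w'))) =
      R\<^sup>2 * Im ((y - w) * cnj (y' - w'))"
    unfolding homothety_mult_cnj by blast+
qed

text \<open>Reality is written as invariance under \<open>cnj\<close>, which turns incidence into a
  polynomial identity in the points and their conjugates.\<close>

lemma mem_homothety_sideline_iff:
  assumes "R > 0" "b \<noteq> c"
  shows "z0 + of_real R * z \<in> sideline (z0 + of_real R * b) (z0 + of_real R * c) \<longleftrightarrow>
    (z - b) * cnj (c - b) = cnj ((z - b) * cnj (c - b))"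
proof -
  have neq: "z0 + of_real R * b \<noteq> z0 + of_real R * c" using assms by simp
  show ?thesis
    unfolding mem_sideline_iff[OF neq] Re_Im_homothety_mult_cnj Im_eq_0_iff_cnj[symmetric]
    using assms(1) by simp
qed

lemma perp_foot_homothety_sidelineI:
  assumes "R > 0" "b \<noteq> c"
    and "(v - b) * cnj (c - b) = cnj ((v - b) * cnj (c - b))"
    and "(x - v) * cnj (c - b) = - cnj ((x - v) * cnj (c - b))"
  shows "perp_foot (z0 + of_real R * x) (sideline (z0 + of_real R * b) (z0 + of_real R * c)) =
    z0 + of_real R * v"
proof (rule perp_foot_sidelineI)
  show "z0 + of_real R * v \<in> sideline (z0 + of_real R * b) (z0 + of_real R * c)"
    unfolding mem_homothety_sideline_iff[OF assms(1,2)] by (rule assms(3))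
  have "Re ((x - v) * cnj (c - b)) = 0"
    unfolding Re_eq_0_iff_cnj by (rule assms(4))
  then show "Re ((z0 + of_real R * x - (z0 + of_real R * v)) *
      cnj (z0 + of_real R * c - (z0 + of_real R * b))) = 0"
    unfolding Re_Im_homothety_mult_cnj by simp
qed

text \<open>The reflection of \<open>x\<close> in the chord is \<open>b + c - b * c * cnj x\<close>,
  and the foot is the midpoint between \<open>x\<close> and this reflection.\<close>

lemma perp_foot_chord:
  assumes "cmod b = 1" "cmod c = 1" "b \<noteq> c" "R > 0"
  shows "perp_foot (z0 + of_real R * x) (sideline (z0 + of_real R * b) (z0 + of_real R * c)) =
    z0 + of_real R * ((x + b + c - b * c * cnj x) / 2)" (is "_ = z0 + _ * ?v")
proof (rule perp_foot_homothety_sidelineI[OF assms(4,3)])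
  have b: "b * cnj b = 1" and c: "c * cnj c = 1" using assms mult_cnj_unit by auto
  show "(?v - b) * cnj (c - b) = cnj ((?v - b) * cnj (c - b))"
    using b c by (simp add: field_simps, algebra)
  show "(x - ?v) * cnj (c - b) = - cnj ((x - ?v) * cnj (c - b))"
    using b c by (simp add: field_simps, algebra)
qed

text \<open>The direction \<open>u\<close> of the Simson line satisfies \<open>u\<^sup>2 = a b c cnj x\<close>, which is read off the
  difference of two feet.\<close>

lemma perp_foot_simson_line:
  assumes "cmod a = 1" "cmod b = 1" "cmod c = 1" "cmod x = 1"
    and "a \<noteq> b" "b \<noteq> c" "c \<noteq> a" and "R > 0"
  defines "v \<equiv> (3 * x + (a + b + c) - (a * b + b * c + c * a) * cnj x + a * b * c * (cnj x)\<^sup>2) / 4"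
  shows "perp_foot (z0 + of_real R * x)
     (simson_line (z0 + of_real R * a, z0 + of_real R * b, z0 + of_real R * c) (z0 + of_real R * x)) =
    z0 + of_real R * v"
proof -
  note units = assms(1-4)[THEN mult_cnj_unit]
  have nz: "a \<noteq> 0" "b \<noteq> 0" "c \<noteq> 0" "x \<noteq> 0" using assms(1-4) by auto
  define u where "u = csqrt (a * b * c * cnj x)"
  have u2: "u * u = a * b * c * cnj x"
    using power2_csqrt[of "a * b * c * cnj x"] by (simp add: u_def power2_eq_square)
  then have "cmod u * cmod u = 1"
    using assms by (metis complex_mod_cnj mult_1 norm_mult)
  then have "cmod u = 1" by (metis abs_norm_cancel real_sqrt_abs2 real_sqrt_one)
  then have u: "u * cnj u = 1" and "u \<noteq> 0" using mult_cnj_unit by auto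
  \<comment> \<open>The line through the expected foot \<open>v\<close> with direction
    \<open>u\<close>. It remains to see that it contains the three feet and is orthogonal to
    \<open>x - v\<close>.\<close>
  define m where "m = sideline (z0 + of_real R * v) (z0 + of_real R * (v + u))"
  have neq: "v \<noteq> v + u" using \<open>u \<noteq> 0\<close> by simp
  \<comment> \<open>Since \<open>u * u = a * b * c * cnj x\<close> and \<open>u\<close> is a unit,
    the premise says that \<open>p - v\<close> is a real multiple of \<open>u\<close>.\<close>
  have mem: "z0 + of_real R * p \<in> m" if "p - v = a * b * c * cnj x * cnj (p - v)" for p
  proof -
    have "(p - v) * cnj u = cnj ((p - v) * cnj u)"
      unfolding complex_cnj_mult complex_cnj_cnj using that u2 u by algebra
    then show ?thesis
      unfolding m_def mem_homothety_sideline_iff[OF assms(8) neq] by simp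
  qed
  define foot where "foot y w = (x + y + w - y * w * cnj x) / 2" for y w
  have foot_mem: "z0 + of_real R * foot y w \<in> m"
    if "z * (y * w) = a * b * c" "z + y + w = a + b + c"
      "z * y + y * w + w * z = a * b + b * c + c * a" "cmod z = 1" "cmod y = 1" "cmod w = 1" for y w z
  proof (rule mem)
    have nz: "z \<noteq> 0" "y \<noteq> 0" "w \<noteq> 0" "x \<noteq> 0" using that(4-6) assms(4) by auto
    have eq: "foot y w - v = (y + w - z - x + (z * y + w * z - y * w) * cnj x
        - z * (y * w) * (cnj x)\<^sup>2) / 4"
      unfolding foot_def v_def that(1-3)[symmetric] by (simp add: field_simps)
    show "foot y w - v = a * b * c * cnj x * cnj (foot y w - v)"
      unfolding eq that(1)[symmetric] using nz
      by (simp add: that(4-6)[THEN cnj_unit] assms(4)[THEN cnj_unit] divide_simps)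
        (simp add: algebra_simps power2_eq_square)
  qed
  have feet: "perp_foot (z0 + of_real R * x) (sideline (z0 + of_real R * b) (z0 + of_real R * c))
        = z0 + of_real R * foot b c"
      "perp_foot (z0 + of_real R * x) (sideline (z0 + of_real R * c) (z0 + of_real R * a))
        = z0 + of_real R * foot c a"
      "perp_foot (z0 + of_real R * x) (sideline (z0 + of_real R * a) (z0 + of_real R * b))
        = z0 + of_real R * foot a b"
    unfolding foot_def using assms by (simp_all add: perp_foot_chord)
  have mems: "z0 + of_real R * foot b c \<in> m" "z0 + of_real R * foot c a \<in> m"
      "z0 + of_real R * foot a b \<in> m"
    using assms by (intro foot_mem[of a] foot_mem[of b] foot_mem[of c]; simp add: ac_simps)+
  have m_line: "is_line m" unfolding m_def using neq assms(8) by (intro is_line_sideline) simp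
  \<comment> \<open>Feet on two sides coincide only if \<open>x\<close> is their common vertex. As
    \<open>x\<close> cannot be two vertices at once, the feet determine a unique line.\<close>
  have foot_eq: "w = x" if "foot y w = foot w z" "y \<noteq> z" for y w z
  proof -
    have "2 * x * (foot y w - foot w z) = (y - z) * (x - w * (x * cnj x))"
      unfolding foot_def by (simp add: field_simps)
    then show ?thesis using that units(4) by simp
  qed
  have "foot b c \<noteq> foot c a \<or> foot c a \<noteq> foot a b"
    using foot_eq[of b c a] foot_eq[of c a b] assms(5-7) by metis
  then have "simson_line (z0 + of_real R * a, z0 + of_real R * b, z0 + of_real R * c)
      (z0 + of_real R * x) = m"
    unfolding simson_line_def prod.case feet
  proof (intro the_equality conjI m_line mems)
    fix l assume "foot b c \<noteq> foot c a \<or> foot c a \<noteq> foot a b"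
      and l: "is_line l \<and> z0 + of_real R * foot b c \<in> l \<and> z0 + of_real R * foot c a \<in> l \<and>
        z0 + of_real R * foot a b \<in> l"
    then have "z0 + of_real R * foot b c \<noteq> z0 + of_real R * foot c a \<or>
        z0 + of_real R * foot c a \<noteq> z0 + of_real R * foot a b"
      using assms(8) by simp
    then show "l = m" using is_line_unique[OF _ m_line] l mems by metis
  qed
  moreover have "perp_foot (z0 + of_real R * x) m = z0 + of_real R * v"
    unfolding m_def
  proof (rule perp_foot_homothety_sidelineI[OF assms(8) neq])
    have eq: "x - v = (x - (a + b + c) + (a * b + b * c + c * a) * cnj x
        - a * b * c * (cnj x)\<^sup>2) / 4"
      unfolding v_def by (simp add: field_simps)
    \<comment> \<open>With the minus sign the relation says that \<open>x - v\<close> is orthogonal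
      to \<open>u\<close>.\<close>
    have "x - v = - (a * b * c * cnj x * cnj (x - v))"
      unfolding eq using nz
      by (simp add: assms(1-4)[THEN cnj_unit] divide_simps) (simp add: algebra_simps power2_eq_square)
    then have "(x - v) * cnj u = - cnj ((x - v) * cnj u)"
      unfolding complex_cnj_mult complex_cnj_cnj using u2 u by algebra
    then show "(x - v) * cnj (v + u - v) = - cnj ((x - v) * cnj (v + u - v))" by simp
  qed simp
  ultimately show ?thesis by simp
qed

section \<open>The Poncelet family in normalised coordinates\<close>

text \<open>Multiplying the collinearity relation by \<open>a * b * c\<close> removes the conjugates
  and leaves \<open>(c - a) * (a - b) * (c - b) = 0\<close>.\<close>

lemma not_collinear_sphere:
  assumes "cmod a = 1" "cmod b = 1" "cmod c = 1" "a \<noteq> b" "b \<noteq> c" "c \<noteq> a" "R > 0"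
  shows "\<not> collinear {z0 + of_real R * a, z0 + of_real R * b, z0 + of_real R * c}"
proof
  note units = assms(1-3)[THEN mult_cnj_unit]
  assume "collinear {z0 + of_real R * a, z0 + of_real R * b, z0 + of_real R * c}"
  moreover have neq: "z0 + of_real R * a \<noteq> z0 + of_real R * b" using assms by simp
  ultimately have "z0 + of_real R * c \<in> sideline (z0 + of_real R * a) (z0 + of_real R * b)"
    unfolding sideline_def by (simp add: collinear_3_affine_hull)
  then have "(c - a) * cnj (b - a) = cnj ((c - a) * cnj (b - a))"
    unfolding mem_homothety_sideline_iff[OF assms(7,4)] .
  then have "(c - a) * (cnj b - cnj a) = (cnj c - cnj a) * (b - a)" by simp
  moreover have "(c - a) * (cnj b - cnj a) * (a * b * c) =
        (c - a) * (a * (b * cnj b) - b * (a * cnj a)) * c"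
      "(cnj c - cnj a) * (b - a) * (a * b * c) =
        (a * (c * cnj c) - c * (a * cnj a)) * (b - a) * b"
    by (simp_all add: algebra_simps)
  ultimately have "(c - a) * (a - b) * c = (a - c) * (b - a) * b"
    unfolding units by simp
  then have "(c - a) * (a - b) * c = (c - a) * (a - b) * b"
    by (simp add: algebra_simps)
  then show False using assms by simp
qed

text \<open>Only the foci are normalised, while \<open>s\<close> keeps its original scale; this is
  the source of the division by \<open>R^2\<close>.\<close>

lemma tangent_to_ellipse_chord_iff:
  assumes "R > 0" "cmod b = 1" "cmod c = 1" "b \<noteq> c"
    and "dist (z0 + of_real R * f) (z0 + of_real R * g) < s"
  shows "tangent_to (sideline (z0 + of_real R * b) (z0 + of_real R * c))
      {z. dist z (z0 + of_real R * f) + dist z (z0 + of_real R * g) = s} \<longleftrightarrow>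
    chord_condition f g ((s\<^sup>2 - (dist (z0 + of_real R * f) (z0 + of_real R * g))\<^sup>2) / R\<^sup>2) b c"
proof -
  define k where "k = s\<^sup>2 - (dist (z0 + of_real R * f) (z0 + of_real R * g))\<^sup>2"
  define N P Q where "N = (cmod (c - b))\<^sup>2" and "P = Im ((f - b) * cnj (c - b))"
    and "Q = Im ((g - b) * cnj (c - b))"
  have neq: "z0 + of_real R * b \<noteq> z0 + of_real R * c" using assms by simp
  have "z0 + of_real R * c - (z0 + of_real R * b) = of_real R * (c - b)"
    by (simp add: algebra_simps)
  then have N: "(cmod (z0 + of_real R * c - (z0 + of_real R * b)))\<^sup>2 = R\<^sup>2 * N"
    by (simp add: norm_mult power_mult_distrib N_def)
  have "k * (R\<^sup>2 * N) - 4 * (R\<^sup>2 * P) * (R\<^sup>2 * Q) = R^4 * (k / R\<^sup>2 * N - 4 * P * Q)"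
    using assms(1) by (simp add: field_simps eval_nat_numeral)
  then have "k * (R\<^sup>2 * N) = 4 * (R\<^sup>2 * P) * (R\<^sup>2 * Q) \<longleftrightarrow> k / R\<^sup>2 * N = 4 * P * Q"
    using assms(1) by (metis eq_iff_diff_eq_0 less_irrefl mult_eq_0_iff power_not_zero)
  then show ?thesis
    unfolding tangent_to_ellipse_iff[OF assms(5) neq] N Re_Im_homothety_mult_cnj
      chord_condition_iff[OF assms(2-4)] k_def N_def P_def Q_def .
qed

text \<open>Noncollinearity turns into distinctness, because points of a circle are collinear only
  if two of them coincide.\<close>

lemma mem_poncelet_family_iff:
  assumes "R > 0"
    and "dist (z0 + of_real R * f) (z0 + of_real R * g) < s"
  defines "k \<equiv> (s\<^sup>2 - (dist (z0 + of_real R * f) (z0 + of_real R * g))\<^sup>2) / R\<^sup>2"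
    and "E \<equiv> {z. dist z (z0 + of_real R * f) + dist z (z0 + of_real R * g) = s}"
  shows "T \<in> poncelet_family (sphere z0 R) E \<longleftrightarrow>
    (\<exists>a b c. T = (z0 + of_real R * a, z0 + of_real R * b, z0 + of_real R * c) \<and>
      cmod a = 1 \<and> cmod b = 1 \<and> cmod c = 1 \<and> a \<noteq> b \<and> b \<noteq> c \<and> c \<noteq> a \<and>
      chord_condition f g k a b \<and> chord_condition f g k b c \<and> chord_condition f g k c a)"
proof
  have tangent: "tangent_to (sideline (z0 + of_real R * b) (z0 + of_real R * c)) E \<longleftrightarrow>
      chord_condition f g k b c" if "cmod b = 1" "cmod c = 1" "b \<noteq> c" for b c
    unfolding E_def k_def using assms(1,2) that by (intro tangent_to_ellipse_chord_iff)
  show "\<exists>a b c. T = (z0 + of_real R * a, z0 + of_real R * b, z0 + of_real R * c) \<and>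
      cmod a = 1 \<and> cmod b = 1 \<and> cmod c = 1 \<and> a \<noteq> b \<and> b \<noteq> c \<and> c \<noteq> a \<and>
      chord_condition f g k a b \<and> chord_condition f g k b c \<and> chord_condition f g k c a"
    if T: "T \<in> poncelet_family (sphere z0 R) E"
  proof -
    obtain A B C where T_eq: "T = (A, B, C)" by (cases T)
    define a b c where "a = (A - z0) / of_real R" and "b = (B - z0) / of_real R"
      and "c = (C - z0) / of_real R"
    have ABC: "A = z0 + of_real R * a" "B = z0 + of_real R * b" "C = z0 + of_real R * c"
      using assms(1) by (simp_all add: a_def b_def c_def)
    have "cmod a = 1" "cmod b = 1" "cmod c = 1"
      using T assms(1) unfolding poncelet_family_def T_eq
      by (auto simp: a_def b_def c_def dist_norm norm_minus_commute norm_divide)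
    moreover have "\<not> collinear {A, B, C}"
      using T unfolding poncelet_family_def T_eq by blast
    then have "A \<noteq> B" "B \<noteq> C" "C \<noteq> A"
      by (metis collinear_2 insert_absorb2 insert_commute)+
    then have "a \<noteq> b" "b \<noteq> c" "c \<noteq> a" by (auto simp: ABC)
    moreover have "tangent_to (sideline A B) E" "tangent_to (sideline B C) E"
        "tangent_to (sideline C A) E"
      using T unfolding poncelet_family_def T_eq by blast+
    ultimately show ?thesis
      unfolding T_eq ABC by (intro exI[of _ a] exI[of _ b] exI[of _ c]) (simp add: tangent)
  qed
  show "T \<in> poncelet_family (sphere z0 R) E"
    if abc: "\<exists>a b c. T = (z0 + of_real R * a, z0 + of_real R * b, z0 + of_real R * c) \<and>
      cmod a = 1 \<and> cmod b = 1 \<and> cmod c = 1 \<and> a \<noteq> b \<and> b \<noteq> c \<and> c \<noteq> a \<and>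
      chord_condition f g k a b \<and> chord_condition f g k b c \<and> chord_condition f g k c a"
  proof -
    have "z0 + of_real R * w \<in> sphere z0 R" if "cmod w = 1" for w
      using assms(1) that by (simp add: dist_norm norm_mult)
    moreover obtain a b c where "T = (z0 + of_real R * a, z0 + of_real R * b, z0 + of_real R * c)"
      "cmod a = 1" "cmod b = 1" "cmod c = 1" "a \<noteq> b" "b \<noteq> c" "c \<noteq> a"
      "chord_condition f g k a b" "chord_condition f g k b c" "chord_condition f g k c a"
      using abc by (elim exE conjE)
    ultimately show ?thesis
      unfolding poncelet_family_def
      by (simp add: tangent not_collinear_sphere assms(1) del: mem_sphere)
  qed
qed

section \<open>The locus\<close>

lemma image_unit_circle:
  fixes w :: complex
  assumes "w \<noteq> 0"
  shows "{p + l * w | l. cmod l = 1} = sphere p (cmod w)"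
proof (intro subset_antisym subsetI)
  fix z assume "z \<in> sphere p (cmod w)"
  then have "cmod ((z - p) / w) = 1" and "z = p + (z - p) / w * w"
    using assms by (simp_all add: dist_norm norm_minus_commute norm_divide)
  then show "z \<in> {p + l * w | l. cmod l = 1}" by blast
qed (auto simp: dist_norm norm_mult)

theorem theorem1:
  fixes z0 F :: complex and R :: real and E :: "complex set"
  assumes "R > 0"
    and "is_ellipse E"
    and "E \<subseteq> ball z0 R"
    and "poncelet_family (sphere z0 R) E \<noteq> {}"
    and "F \<in> sphere z0 R"
  shows "is_circle {perp_foot F (simson_line T F) | T. T \<in> poncelet_family (sphere z0 R) E}"
proof -
  obtain f' g' s where "dist f' g' < s" and E': "E = {z. dist z f' + dist z g' = s}"
    using assms(2) unfolding is_ellipse_def by blast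
  define f g x where "f = (f' - z0) / of_real R" and "g = (g' - z0) / of_real R"
    and "x = (F - z0) / of_real R"
  have f': "f' = z0 + of_real R * f" and g': "g' = z0 + of_real R * g" and F: "F = z0 + of_real R * x"
    using assms(1) by (simp_all add: f_def g_def x_def)
  have fg: "dist (z0 + of_real R * f) (z0 + of_real R * g) < s"
    using \<open>dist f' g' < s\<close> unfolding f' g' .
  note E = E'[unfolded f' g']
  have "f' \<in> ball z0 R" "g' \<in> ball z0 R"
    using foci_in_convex[OF \<open>dist f' g' < s\<close> assms(3)[unfolded E'] convex_ball] by this
  then have f: "cmod f < 1" and g: "cmod g < 1"
    using assms(1) by (simp_all add: f_def g_def dist_norm norm_minus_commute norm_divide)
  have x: "cmod x = 1"
    using assms(1,5) by (simp add: x_def dist_norm norm_minus_commute norm_divide)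
  define k where "k = (s\<^sup>2 - (dist (z0 + of_real R * f) (z0 + of_real R * g))\<^sup>2) / R\<^sup>2"
  note family = mem_poncelet_family_iff[OF assms(1) fg, folded k_def E]
  \<comment> \<open>A single triangle of the family fixes \<open>k\<close> in terms of the foci. The
    triangles built from arbitrary \<open>l\<close> are therefore tangent to this very
    ellipse.\<close>
  obtain T0 where "T0 \<in> poncelet_family (sphere z0 R) E" using assms(4) by blast
  then obtain a0 b0 c0 where "cmod a0 = 1" "a0 \<noteq> b0" "b0 \<noteq> c0" "c0 \<noteq> a0"
    "chord_condition f g k a0 b0" "chord_condition f g k b0 c0" "chord_condition f g k c0 a0"
    unfolding family by (elim exE conjE)
  moreover from this have "a0 \<noteq> 0" by auto
  ultimately have k: "k = (1 - (cmod f)\<^sup>2) * (1 - (cmod g)\<^sup>2)"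
    by (intro chord_conditions_imp(2))
  \<comment> \<open>The constant term and the coefficient of \<open>l\<close> in the foot formula,
    once the symmetric functions of the vertices are expressed by \<open>f\<close>, \<open>g\<close>
    and \<open>l\<close>.\<close>
  define q e where "q = (3 * x + (f + g) - f * g * cnj x) / 4"
    and "e = (cnj x - cnj f) * (cnj x - cnj g) / 4"
  define p w where "p = z0 + of_real R * q" and "w = of_real R * e"
  have foot: "perp_foot F (simson_line (z0 + of_real R * a, z0 + of_real R * b, z0 + of_real R * c) F)
      = p + a * b * c * w"
    if "cmod a = 1" "cmod b = 1" "cmod c = 1" "a \<noteq> b" "b \<noteq> c" "c \<noteq> a"
      "chord_condition f g k a b" "chord_condition f g k b c" "chord_condition f g k c a" for a b c
  proof -
    note units = that(1-3)[THEN mult_cnj_unit]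
    define l where "l = a * b * c"
    have "a \<noteq> 0" using that by auto
    then have sum: "a + b + c = f + g + l * cnj f * cnj g"
      unfolding l_def using that by (intro chord_conditions_imp(1))
    \<comment> \<open>On the unit circle the second symmetric function is \<open>l\<close> times the
      conjugate of the first, so \<open>sum\<close> yields \<open>sum2\<close>.\<close>
    have "l * (cnj a + cnj b + cnj c) = a * b * (c * cnj c) + b * c * (a * cnj a) + c * a * (b * cnj b)"
      by (simp add: l_def algebra_simps)
    then have "a * b + b * c + c * a = l * cnj (a + b + c)"
      unfolding units by simp
    also have "\<dots> = l * (cnj f + cnj g) + l * cnj l * (f * g)"
      unfolding sum by (simp add: algebra_simps)
    also have "l * cnj l = 1"
      using that by (intro mult_cnj_unit) (simp add: l_def norm_mult)
    finally have sum2: "a * b + b * c + c * a = l * (cnj f + cnj g) + f * g" by simp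
    have "(3 * x + (a + b + c) - (a * b + b * c + c * a) * cnj x + a * b * c * (cnj x)\<^sup>2) / 4 =
      q + l * e"
      unfolding sum sum2 l_def[symmetric] q_def e_def
      by (simp add: add_divide_distrib diff_divide_distrib algebra_simps power2_eq_square)
    then show ?thesis
      unfolding F perp_foot_simson_line[OF that(1-3) x that(4-6) assms(1)] p_def w_def l_def[symmetric]
      by (simp add: distrib_left mult.left_commute)
  qed
  have "{perp_foot F (simson_line T F) | T. T \<in> poncelet_family (sphere z0 R) E} =
      {p + l * w | l. cmod l = 1}"
  proof (intro subset_antisym subsetI)
    fix V assume "V \<in> {perp_foot F (simson_line T F) | T. T \<in> poncelet_family (sphere z0 R) E}"
    then obtain T where V: "V = perp_foot F (simson_line T F)"
      and T: "T \<in> poncelet_family (sphere z0 R) E" by blast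
    obtain a b c where T_eq: "T = (z0 + of_real R * a, z0 + of_real R * b, z0 + of_real R * c)"
      and abc: "cmod a = 1" "cmod b = 1" "cmod c = 1" "a \<noteq> b" "b \<noteq> c" "c \<noteq> a"
        "chord_condition f g k a b" "chord_condition f g k b c" "chord_condition f g k c a"
      using T unfolding family by (elim exE conjE)
    have "V = p + a * b * c * w" unfolding V T_eq foot[OF abc] ..
    moreover have "cmod (a * b * c) = 1" using abc by (simp add: norm_mult)
    ultimately show "V \<in> {p + l * w | l. cmod l = 1}" by blast
  next
    fix V assume "V \<in> {p + l * w | l. cmod l = 1}"
    then obtain l where l1: "cmod l = 1" and V: "V = p + l * w" by blast
    obtain a b c where abc: "cmod a = 1" "cmod b = 1" "cmod c = 1" "a \<noteq> b" "b \<noteq> c" "c \<noteq> a"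
      "chord_condition f g k a b" "chord_condition f g k b c" "chord_condition f g k c a"
      and l: "a * b * c = l"
      by (rule chord_triangle_exists[OF f g l1, folded k])
    have "V = perp_foot F (simson_line (z0 + of_real R * a, z0 + of_real R * b, z0 + of_real R * c) F)"
      unfolding foot[OF abc] V l ..
    moreover have "(z0 + of_real R * a, z0 + of_real R * b, z0 + of_real R * c)
        \<in> poncelet_family (sphere z0 R) E"
      unfolding family using abc by (intro exI[of _ a] exI[of _ b] exI[of _ c]) simp
    ultimately show "V \<in> {perp_foot F (simson_line T F) | T. T \<in> poncelet_family (sphere z0 R) E}"
      by blast
  qed
  moreover have "w \<noteq> 0"
  proof -
    \<comment> \<open>The foci lie strictly inside the unit circle and \<open>x\<close> lies on it,
      so the radius is positive.\<close>
    have "x \<noteq> f" "x \<noteq> g" using f g x by auto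
    then show ?thesis using assms(1) by (simp add: w_def e_def)
  qed
  ultimately show ?thesis
    unfolding is_circle_def by (intro exI[of _ p] exI[of _ "cmod w"]) (simp add: image_unit_circle)
qed

end
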